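(* Let $q$ be a prime power and $d\geq0$ an integer. If $d<q-1$, then \[ \mathcal{R}(q,d)\leq\frac{q+1}{d+2}+\left(1+\frac{2}{q^2}\right)\sum_{k=1}^{d+1}\left(\frac{1}{k}\right). \] If $d\geq q-1$, then \[ \mathcal{R}(q,d)\leq\left(1+\frac{2}{q^2}\right)\sum_{k=1}^{q+1}\left(\frac{1}{k}\right). \]
   Context: A rational function on $\mathbb{P}^1(\mathbb{F}_q)$ is an element of $\mathbb{F}_q(x)$ or the constant function $\infty$; all constant functions, including the constant $\infty$, have degree $0$, and otherwise the degree of $f/g$ with $f,g\in\mathbb{F}_q[x]$ coprime is $\max\{\deg f,\deg g\}$. For a rational function $f$ on $\mathbb{P}^1(\mathbb{F}_q)$, the functional graph $\Gamma_f$ is the directed graph with vertex set $\mathbb{P}^1(\mathbb{F}_q)$ and an edge $\alpha\to\beta$ if and only if $f(\alpha)=\beta$. A $k$-cycle in $\Gamma_f$ is an orbit $\alpha_1\to\alpha_2\to\cdots\to\alpha_k\to\alpha_1$ under $f$ with $\alpha_1,\ldots,\alpha_k\in\mathbb{P}^1(\mathbb{F}_q)$ distinct (taken up to cyclic rotation); a cycle is a $k$-cycle for some $k\geq1$. The cycles of $\Gamma_f$ are in bijection with its connected components (connected components of the underlying undirected graph). $\mathcal{R}(q,d)$ denotes the average of $\left|\{\text{cycles in }\Gamma_f\}\right|$ over all rational functions $f$ on $\mathbb{P}^1(\mathbb{F}_q)$ of degree exactly $d$. *)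

theory Defs
  imports
    Complex_Main
    "HOL-Library.Cardinality"
    "HOL-Computational_Algebra.Fraction_Field"
    "HOL-Computational_Algebra.Polynomial"
    "HOL-Computational_Algebra.Primes"
begin

(* The point at infinity is None.  A rational function on the projective line over 'a is thus a
   point of the projective line over 'a(x), with None the constant function infinity. *)
type_synonym 'a proj_line = "'a option"
type_synonym 'a ratfun = "'a poly fract proj_line"

definition reduced_fraction :: "'a::field poly fract \<Rightarrow> 'a poly \<Rightarrow> 'a poly \<Rightarrow> bool" where
  "reduced_fraction r f g \<longleftrightarrow> r = Fraction_Field.Fract f g \<and> coprime f g \<and> lead_coeff g = 1"

lemma reduced_fraction_exists: "\<exists>f g. reduced_fraction r f g"
proof -
  define P where "P g \<longleftrightarrow> g \<noteq> 0 \<and> (\<exists>f. r = Fraction_Field.Fract f g)" for g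
  have "\<exists>g. P g"
    by (cases r) (auto simp: P_def)
  then obtain g where g: "P g" and min: "\<And>h. P h \<Longrightarrow> degree g \<le> degree h"
    using exists_least_iff[of "\<lambda>n. \<exists>g. P g \<and> degree g = n"] by (metis linorder_not_less)
  from g obtain f where f: "r = Fraction_Field.Fract f g" and g0: "g \<noteq> 0"
    by (auto simp: P_def)
  have cop: "coprime f g"
  proof (rule coprimeI)
    fix c assume "c dvd f" "c dvd g"
    then obtain f' g' where c: "f = c * f'" "g = c * g'"
      by (elim dvdE)
    with g0 have nz: "c \<noteq> 0" "g' \<noteq> 0"
      by auto
    then have "r = Fraction_Field.Fract f' g'"
      using f c by (simp add: eq_fract)
    with nz have "P g'"
      by (auto simp: P_def)
    from min[OF this] have "degree c = 0"
      using c nz by (simp add: degree_mult_eq)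
    with nz show "is_unit c"
      by (simp add: is_unit_iff_degree)
  qed
  define a where "a = inverse (lead_coeff g)"
  have a: "a \<noteq> 0"
    using g0 by (simp add: a_def)
  have "coprime (smult a f) (smult a g)"
    using cop a by (auto simp: coprime_def dvd_smult_iff)
  moreover have "r = Fraction_Field.Fract (smult a f) (smult a g)"
    using f g0 a by (simp add: eq_fract)
  moreover have "lead_coeff (smult a g) = 1"
    using g0 by (simp add: a_def)
  ultimately show ?thesis
    unfolding reduced_fraction_def by blast
qed

lemma coprime_poly_bezout:
  fixes f g :: "'a::field poly"
  assumes "coprime f g" and "g \<noteq> 0"
  shows "\<exists>a b. a * f + b * g = 1"
proof -
  define P where "P h \<longleftrightarrow> h \<noteq> 0 \<and> (\<exists>a b. h = a * f + b * g)" for h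
  have "g = 0 * f + 1 * g"
    by simp
  then have "P g"
    unfolding P_def using assms(2) by blast
  then obtain h where h: "P h" and min: "\<And>k. P k \<Longrightarrow> degree h \<le> degree k"
    using exists_least_iff[of "\<lambda>n. \<exists>g. P g \<and> degree g = n"] by (metis linorder_not_less)
  from h obtain a b where ab: "h = a * f + b * g" and h0: "h \<noteq> 0"
    by (auto simp: P_def)
  have dvd: "h dvd k" if k: "k = c * f + d * g" for k c d
  proof (rule ccontr)
    assume "\<not> h dvd k"
    then have nz: "k mod h \<noteq> 0"
      by (simp add: dvd_eq_mod_eq_0)
    have "k mod h = k - (k div h) * h"
      by (simp add: minus_div_mult_eq_mod)
    also have "\<dots> = (c - (k div h) * a) * f + (d - (k div h) * b) * g"
      using k ab by (simp add: algebra_simps)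
    finally have "P (k mod h)"
      unfolding P_def using nz by blast
    with min degree_mod_less'[OF h0 nz] show False
      by (meson linorder_not_less)
  qed
  have "h dvd f" "h dvd g"
    using dvd[of f 1 0] dvd[of g 0 1] by simp_all
  with assms(1) have "is_unit h"
    by (auto simp: coprime_def)
  then obtain u where "1 = h * u"
    by (elim dvdE)
  then have "(u * a) * f + (u * b) * g = 1"
    using ab by (simp add: algebra_simps)
  then show ?thesis
    by blast
qed

lemma reduced_fraction_unique:
  assumes "reduced_fraction r f g" and "reduced_fraction r f' g'"
  shows "f = f' \<and> g = g'"
proof -
  have nz: "g \<noteq> 0" "g' \<noteq> 0" and lc: "lead_coeff g = 1" "lead_coeff g' = 1"
    using assms by (auto simp: reduced_fraction_def)
  have cop: "coprime f g" "coprime f' g'" and eq: "f * g' = f' * g"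
    using assms nz by (auto simp: reduced_fraction_def eq_fract)
  obtain a b where ab: "a * f + b * g = 1"
    using coprime_poly_bezout[OF cop(1) nz(1)] by blast
  obtain a' b' where ab': "a' * f' + b' * g' = 1"
    using coprime_poly_bezout[OF cop(2) nz(2)] by blast
  have "g' = (a * f + b * g) * g'"
    by (simp add: ab)
  also have "\<dots> = a * (f * g') + b * g * g'"
    by (simp add: algebra_simps)
  also have "\<dots> = g * (a * f' + b * g')"
    unfolding eq by (simp add: algebra_simps)
  finally have 1: "g dvd g'"
    by (metis dvd_triv_left)
  have "g = (a' * f' + b' * g') * g"
    by (simp add: ab')
  also have "\<dots> = a' * (f' * g) + b' * g' * g"
    by (simp add: algebra_simps)
  also have "\<dots> = g' * (a' * f + b' * g)"
    unfolding eq[symmetric] by (simp add: algebra_simps)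
  finally have 2: "g' dvd g"
    by (metis dvd_triv_left)
  have "g = g'"
  proof -
    obtain h where h: "g' = g * h"
      using 1 by (elim dvdE)
    with nz have "h \<noteq> 0"
      by auto
    moreover have "degree g' \<le> degree g"
      using 2 nz(1) by (rule dvd_imp_degree_le)
    ultimately have "degree h = 0"
      using h nz by (simp add: degree_mult_eq)
    then obtain c where "h = [:c:]"
      by (rule degree_eq_zeroE)
    with h lc show ?thesis
      by (cases "c = 0") simp_all
  qed
  with eq nz show ?thesis
    by simp
qed

definition numer :: "'a::field poly fract \<Rightarrow> 'a poly" where
  "numer r = (THE f. \<exists>g. reduced_fraction r f g)"

definition denom :: "'a::field poly fract \<Rightarrow> 'a poly" where
  "denom r = (THE g. \<exists>f. reduced_fraction r f g)"

lemma reduced_fraction_numer_denom: "reduced_fraction r (numer r) (denom r)"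
proof -
  obtain f g where fg: "reduced_fraction r f g"
    using reduced_fraction_exists by blast
  have "numer r = f" "denom r = g"
    unfolding numer_def denom_def
    using fg by (blast intro: the_equality dest: reduced_fraction_unique)+
  with fg show ?thesis
    by simp
qed

fun rf_degree :: "'a::field ratfun \<Rightarrow> nat" where
  "rf_degree None = 0"
| "rf_degree (Some r) = max (degree (numer r)) (degree (denom r))"

(* The value of f/g at infinity is the ratio of the coefficients of x^n in f and g, where
   n = max (deg f) (deg g); if deg f <= deg g then n = deg g and g is monic. *)
fun rf_eval :: "'a::field ratfun \<Rightarrow> 'a proj_line \<Rightarrow> 'a proj_line" where
  "rf_eval None \<alpha> = None"
| "rf_eval (Some r) (Some a) =
     (if poly (denom r) a = 0 then None else Some (poly (numer r) a / poly (denom r) a))"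
| "rf_eval (Some r) None =
     (if degree (numer r) > degree (denom r) then None
      else Some (coeff (numer r) (degree (denom r)) / lead_coeff (denom r)))"

definition functional_graph :: "('v \<Rightarrow> 'v) \<Rightarrow> 'v rel" where
  "functional_graph f = {(\<alpha>, \<beta>). f \<alpha> = \<beta>}"

definition cyclic_walks :: "'v rel \<Rightarrow> nat \<Rightarrow> 'v list set" where
  "cyclic_walks E k =
     {xs. length xs = k \<and> distinct xs \<and> (\<forall>i<k. (xs ! i, xs ! (Suc i mod k)) \<in> E)}"

definition k_cycles :: "'v rel \<Rightarrow> nat \<Rightarrow> 'v list set set" where
  "k_cycles E k = cyclic_walks E k // {(xs, ys). \<exists>n. ys = rotate n xs}"

definition cycles :: "'v rel \<Rightarrow> 'v list set set" where
  "cycles E = (\<Union>k\<in>{1..}. k_cycles E k)"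

definition rf_of_degree :: "nat \<Rightarrow> 'a::field ratfun set" where
  "rf_of_degree d = {f. rf_degree f = d}"

lemma finite_rf_of_degree: "finite (rf_of_degree d :: 'a::finite_field ratfun set)"
proof -
  let ?B = "{p :: 'a poly. degree p \<le> d}"
  have "finite ?B"
  proof (rule finite_subset)
    show "?B \<subseteq> Poly ` {xs. set xs \<subseteq> UNIV \<and> length xs \<le> Suc d}"
    proof
      fix p :: "'a poly" assume "p \<in> ?B"
      then have "length (coeffs p) \<le> Suc d"
        by (simp add: length_coeffs_degree coeffs_def)
      then show "p \<in> Poly ` {xs. set xs \<subseteq> UNIV \<and> length xs \<le> Suc d}"
        by (intro image_eqI[of _ _ "coeffs p"]) simp_all
    qed
    show "finite (Poly ` {xs :: 'a list. set xs \<subseteq> UNIV \<and> length xs \<le> Suc d})"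
      by (intro finite_imageI finite_lists_length_le) simp
  qed
  moreover have "rf_of_degree d \<subseteq> insert None ((\<lambda>(f, g). Some (Fraction_Field.Fract f g)) ` (?B \<times> ?B))"
  proof
    fix h :: "'a ratfun" assume h: "h \<in> rf_of_degree d"
    show "h \<in> insert None ((\<lambda>(f, g). Some (Fraction_Field.Fract f g)) ` (?B \<times> ?B))"
    proof (cases h)
      case (Some r)
      have "r = Fraction_Field.Fract (numer r) (denom r)"
        using reduced_fraction_numer_denom[of r] by (simp add: reduced_fraction_def)
      with h Some show ?thesis
        by (force simp: rf_of_degree_def)
    qed simp
  qed
  ultimately show ?thesis
    by (meson finite_SigmaI finite_imageI finite_insert finite_subset)
qed

(* R(q,d) with q = CARD('a); rational functions are averaged over as elements of 'a(x) or
   infinity, even if several of them induce the same map on the projective line. *)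
definition avg_cycles :: "'a::finite_field itself \<Rightarrow> nat \<Rightarrow> real" where
  "avg_cycles _ d =
     (\<Sum>f\<in>(rf_of_degree d :: 'a ratfun set). real (card (cycles (functional_graph (rf_eval f)))))
       / real (card (rf_of_degree d :: 'a ratfun set))"

end

(* Counting cyclic walks instead of cycles, it suffices that a function of degree d has on average at
   most one cyclic walk of length k, for every k <= d + 2: this gives at most 1/k cycles of length k,
   and there are at most (q+1)/(d+2) cycles of length at least d + 2 since cycles are disjoint.

   Put D_k for the number of k-tuples of distinct points and N for the number of functions of
   degree d, as coprime pairs of forms, that take k prescribed distinct values at k prescribed
   distinct points. The average is at most 1 as soon as N * D_k is at most the number of all coprime
   pairs. For k <= 3 this follows from 3-transitivity of PGL_2 acting on the values, since N is then
   independent of the values. For 4 <= k <= d + 2 the k linear conditions on pairs of forms are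
   independent, so N <= q^(2d+2-k), while D_k <= (q+1)q(q-1)(q-2)q^(k-4) and there are at least
   (q+1)(q-1)^2 q^(2d-1) coprime pairs. *)

theory Submission
  imports Defs
begin

subsection \<open>Rational functions as coprime pairs of binary forms\<close>

text \<open>A polynomial of degree at most \<open>d\<close> stands for its homogenization of degree \<open>d\<close>,
  evaluated at the coordinates \<open>(1 : 0)\<close> of infinity and \<open>(a : 1)\<close> of a finite point.\<close>

definition form_eval :: "nat \<Rightarrow> 'a::field poly \<Rightarrow> 'a proj_line \<Rightarrow> 'a" where
  "form_eval d F \<alpha> = (case \<alpha> of None \<Rightarrow> coeff F d | Some a \<Rightarrow> poly F a)"

lemma form_eval_simps [simp]:
  "form_eval d F None = coeff F d" "form_eval d F (Some a) = poly F a"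
  by (simp_all add: form_eval_def)

lemma form_eval_linear [simp]:
  "form_eval d (F + G) \<alpha> = form_eval d F \<alpha> + form_eval d G \<alpha>"
  "form_eval d (smult c F) \<alpha> = c * form_eval d F \<alpha>"
  "form_eval d 0 \<alpha> = 0"
  by (cases \<alpha>; simp)+

definition hx :: "'a::field proj_line \<Rightarrow> 'a" where
  "hx \<alpha> = (case \<alpha> of None \<Rightarrow> 1 | Some a \<Rightarrow> a)"

definition hy :: "'a::field proj_line \<Rightarrow> 'a" where
  "hy \<alpha> = (case \<alpha> of None \<Rightarrow> 0 | Some a \<Rightarrow> 1)"

lemma hx_hy_simps [simp]:
  "hx None = 1" "hx (Some a) = a" "hy None = 0" "hy (Some a) = 1"
  by (simp_all add: hx_def hy_def)

lemma hx_hy_eq_iff: "hx \<alpha> * hy \<beta> = hy \<alpha> * hx \<beta> \<longleftrightarrow> \<alpha> = \<beta>"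
  by (cases \<alpha>; cases \<beta>) auto

definition pair_eval :: "nat \<Rightarrow> 'a::field poly \<times> 'a poly \<Rightarrow> 'a proj_line \<Rightarrow> 'a proj_line" where
  "pair_eval d p \<alpha> =
     (if form_eval d (snd p) \<alpha> = 0 then None
      else Some (form_eval d (fst p) \<alpha> / form_eval d (snd p) \<alpha>))"

text \<open>Demanding the exact maximal degree \<open>d\<close> excludes a common zero at infinity,
  so these are the pairs of forms of degree \<open>d\<close> without a common factor.\<close>

definition coprime_pairs :: "nat \<Rightarrow> ('a::field poly \<times> 'a poly) set" where
  "coprime_pairs d = {(F, G). coprime F G \<and> max (degree F) (degree G) = d}"

lemma coprime_pairs_nonvanishing:
  assumes "(F, G) \<in> coprime_pairs d"
  shows "form_eval d F \<alpha> \<noteq> 0 \<or> form_eval d G \<alpha> \<noteq> 0"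
proof (cases \<alpha>)
  case None
  have "F \<noteq> 0 \<or> G \<noteq> 0"
    using assms by (auto simp: coprime_pairs_def)
  then have "coeff F d \<noteq> 0 \<or> coeff G d \<noteq> 0"
    using assms by (auto simp: coprime_pairs_def max_def split: if_splits)
      (metis leading_coeff_0_iff)+
  with None show ?thesis
    by simp
next
  case (Some a)
  have "\<not> ([:-a, 1:] dvd F \<and> [:-a, 1:] dvd G)"
    using assms coprime_common_divisor[of F G "[:-a, 1:]"]
    by (auto simp: coprime_pairs_def is_unit_iff_degree)
  then show ?thesis
    using Some by (simp add: poly_eq_0_iff_dvd)
qed

text \<open>Cross-multiplying with the coordinates of \<open>\<beta>\<close> makes a prescribed
  value one linear condition on the coefficients of the pair. At a common zero the condition would
  hold for every \<open>\<beta>\<close>; coprimality rules this out.\<close>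

lemma pair_eval_eq_iff:
  assumes "p \<in> coprime_pairs d"
  shows "pair_eval d p \<alpha> = \<beta> \<longleftrightarrow>
           form_eval d (fst p) \<alpha> * hy \<beta> = form_eval d (snd p) \<alpha> * hx \<beta>"
  using coprime_pairs_nonvanishing[of "fst p" "snd p" d \<alpha>] assms
  by (cases \<beta>) (auto simp: pair_eval_def field_simps)

section \<open>Correspondence between rational functions and coprime pairs up to scaling\<close>

definition scaled_pair :: "'a::field ratfun \<times> 'a \<Rightarrow> 'a poly \<times> 'a poly" where
  "scaled_pair = (\<lambda>(f, c). case f of None \<Rightarrow> ([:c:], 0)
     | Some r \<Rightarrow> (smult c (numer r), smult c (denom r)))"

lemma denom_nonzero [simp]: "denom r \<noteq> 0"
  using reduced_fraction_numer_denom[of r] by (auto simp: reduced_fraction_def)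

lemma coprime_smult_smult:
  fixes F G :: "'a::field poly"
  shows "c \<noteq> 0 \<Longrightarrow> coprime (smult c F) (smult c G) \<longleftrightarrow> coprime F G"
  by (auto simp: coprime_def dvd_smult_iff)

lemma pair_eval_scaled_pair:
  assumes "f \<in> rf_of_degree d" "c \<noteq> 0"
  shows "pair_eval d (scaled_pair (f, c)) = rf_eval f"
proof
  fix \<alpha>
  show "pair_eval d (scaled_pair (f, c)) \<alpha> = rf_eval f \<alpha>"
  proof (cases f)
    case None
    then show ?thesis
      by (cases \<alpha>) (simp_all add: pair_eval_def scaled_pair_def)
  next
    case (Some r)
    then have d: "d = max (degree (numer r)) (degree (denom r))"
      using assms by (simp add: rf_of_degree_def)
    show ?thesis
    \<comment> \<open>The split matters only at infinity, where \<open>rf_eval\<close> reads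
      coefficients at \<open>degree (denom r)\<close> and the forms read them at \<open>d\<close>.
      These indices agree unless infinity is a pole.\<close>
    proof (cases "degree (denom r) < degree (numer r)")
      case True
      with d have "coeff (denom r) d = 0"
        by (simp add: coeff_eq_0)
      with True show ?thesis
        using Some assms(2) by (cases \<alpha>) (simp_all add: pair_eval_def scaled_pair_def)
    next
      case False
      with d have "d = degree (denom r)"
        by simp
      with False show ?thesis
        using Some assms(2) by (cases \<alpha>) (simp_all add: pair_eval_def scaled_pair_def)
    qed
  qed
qed

text \<open>A pair with nonzero second component is a reduced fraction with monic denominator,
  scaled by the leading coefficient of that component. A coprime pair \<open>(F, 0)\<close> has
  constant \<open>F\<close> and represents the function infinity.\<close>

lemma bij_betw_scaled_pair:
  "bij_betw scaled_pair (rf_of_degree d \<times> (- {0})) (coprime_pairs d :: ('a::field poly \<times> 'a poly) set)"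
  unfolding bij_betw_def
proof
  show "inj_on (scaled_pair :: 'a ratfun \<times> 'a \<Rightarrow> _) (rf_of_degree d \<times> (- {0}))"
  proof (rule inj_onI)
    fix x y :: "'a ratfun \<times> 'a"
    assume "x \<in> rf_of_degree d \<times> (- {0})" "y \<in> rf_of_degree d \<times> (- {0})"
      and xy: "scaled_pair x = scaled_pair y"
    then obtain f c f' c' where x: "x = (f, c)" and y: "y = (f', c')" and nz: "c \<noteq> 0" "c' \<noteq> 0"
      by auto
    note eq = xy[unfolded x y]
    have "f = f' \<and> c = c'"
    proof (cases f)
      case None
      with nz eq show ?thesis
        by (cases f') (auto simp: scaled_pair_def)
    next
      case (Some r)
      with nz eq obtain r' where f': "f' = Some r'"
        by (cases f') (auto simp: scaled_pair_def)
      have num: "smult c (numer r) = smult c' (numer r')"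
        and den: "smult c (denom r) = smult c' (denom r')"
        using eq Some f' by (auto simp: scaled_pair_def)
      note R = reduced_fraction_numer_denom[of r, unfolded reduced_fraction_def]
        reduced_fraction_numer_denom[of r', unfolded reduced_fraction_def]
      have "lead_coeff (smult c (denom r)) = lead_coeff (smult c' (denom r'))"
        using den by (rule arg_cong)
      then have c: "c = c'"
        using R by (metis lead_coeff_smult mult.right_neutral)
      then have "numer r = numer r'" "denom r = denom r'"
        using num den nz by (simp_all add: poly_eq_iff)
      then have "r = r'"
        using R by metis
      then show ?thesis
        using c Some f' by simp
    qed
    then show "x = y"
      by (simp add: x y)
  qed
  show "scaled_pair ` (rf_of_degree d \<times> (- {0})) = (coprime_pairs d :: ('a poly \<times> 'a poly) set)"
  proof (intro equalityI subsetI)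
    fix p :: "'a poly \<times> 'a poly" assume "p \<in> scaled_pair ` (rf_of_degree d \<times> (- {0}))"
    then obtain f c where fc: "f \<in> rf_of_degree d" "c \<noteq> 0" "p = scaled_pair (f, c)"
      by auto
    show "p \<in> coprime_pairs d"
    proof (cases f)
      case None
      then show ?thesis
        using fc by (auto simp: rf_of_degree_def scaled_pair_def coprime_pairs_def is_unit_iff_degree)
    next
      case (Some r)
      then show ?thesis
        using fc reduced_fraction_numer_denom[of r]
        by (auto simp: rf_of_degree_def scaled_pair_def coprime_pairs_def reduced_fraction_def
             coprime_smult_smult)
    qed
  next
    fix p :: "'a poly \<times> 'a poly" assume p: "p \<in> coprime_pairs d"
    obtain F G where FG: "p = (F, G)"
      by (cases p)
    with p have cop: "coprime F G" and deg: "max (degree F) (degree G) = d"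
      by (auto simp: coprime_pairs_def)
    show "p \<in> scaled_pair ` (rf_of_degree d \<times> (- {0}))"
    proof (cases "G = 0")
      case True
      with cop have "is_unit F" "F \<noteq> 0"
        by auto
      then have "degree F = 0"
        by (simp add: is_unit_iff_degree)
      then obtain c where "F = [:c:]"
        by (rule degree_eq_zeroE)
      with \<open>F \<noteq> 0\<close> show ?thesis
        using True FG deg
        by (intro image_eqI[of _ _ "(None, c)"]) (auto simp: scaled_pair_def rf_of_degree_def)
    next
      case False
      define c where "c = lead_coeff G"
      have c: "c \<noteq> 0"
        using False by (simp add: c_def)
      define r where "r = Fraction_Field.Fract F G"
      have red: "reduced_fraction r (smult (inverse c) F) (smult (inverse c) G)"
        using False c cop by (simp add: reduced_fraction_def r_def eq_fract coprime_smult_smult c_def)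
      have *: "numer r = smult (inverse c) F" "denom r = smult (inverse c) G"
        using reduced_fraction_unique[OF reduced_fraction_numer_denom red] by auto
      then show ?thesis
        using c deg FG
        by (intro image_eqI[of _ _ "(Some r, c)"]) (auto simp: scaled_pair_def rf_of_degree_def)
    qed
  qed
qed

lemma finite_coprime_pairs: "finite (coprime_pairs d :: ('a::finite_field poly \<times> 'a poly) set)"
proof -
  have "finite ((rf_of_degree d :: 'a ratfun set) \<times> (- {0 :: 'a}))"
    by (intro finite_cartesian_product finite_rf_of_degree finite)
  then show ?thesis
    using bij_betw_finite[OF bij_betw_scaled_pair] by blast
qed

lemma card_nonzero: "card (- {0 :: 'a::{finite,zero}}) = CARD('a) - 1"
  unfolding Compl_eq_Diff_UNIV by (rule card_Diff_singleton) simp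

lemma sum_coprime_pairs:
  fixes h :: "('a::finite_field proj_line \<Rightarrow> 'a proj_line) \<Rightarrow> 'b::semiring_1"
  shows "(\<Sum>p\<in>coprime_pairs d. h (pair_eval d p)) =
         of_nat (CARD('a) - 1) * (\<Sum>f\<in>rf_of_degree d. h (rf_eval f))"
proof -
  have "(\<Sum>p\<in>coprime_pairs d. h (pair_eval d p)) =
        (\<Sum>x\<in>rf_of_degree d \<times> (- {0}). h (pair_eval d (scaled_pair x)))"
    by (rule sum.reindex_bij_betw[OF bij_betw_scaled_pair, symmetric])
  also have "\<dots> = (\<Sum>(f, c)\<in>rf_of_degree d \<times> (- {0 :: 'a}). h (rf_eval f))"
  proof (intro sum.cong refl)
    fix x :: "'a ratfun \<times> 'a" assume "x \<in> rf_of_degree d \<times> (- {0})"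
    then obtain f c where "x = (f, c)" "f \<in> rf_of_degree d" "c \<noteq> 0"
      by auto
    then show "h (pair_eval d (scaled_pair x)) = (case x of (f, c) \<Rightarrow> h (rf_eval f))"
      using pair_eval_scaled_pair[of f d c] by simp
  qed
  also have "\<dots> = of_nat (CARD('a) - 1) * (\<Sum>f\<in>rf_of_degree d. h (rf_eval f))"
    by (simp add: sum.cartesian_product[symmetric] card_nonzero sum_distrib_left)
  finally show ?thesis .
qed

subsection \<open>Functions with few prescribed values\<close>

definition fiber :: "nat \<Rightarrow> 'a::field proj_line list \<Rightarrow> 'a proj_line list \<Rightarrow> ('a poly \<times> 'a poly) set" where
  "fiber d xs ys = {p \<in> coprime_pairs d. map (pair_eval d p) xs = ys}"

lemma finite_fiber: "finite (fiber d xs ys :: ('a::finite_field poly \<times> 'a poly) set)"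
  unfolding fiber_def by (rule finite_subset[OF _ finite_coprime_pairs]) auto

lemma mem_fiber_iff:
  "p \<in> fiber d xs ys \<longleftrightarrow> p \<in> coprime_pairs d \<and> length xs = length ys \<and>
     (\<forall>i<length xs. form_eval d (fst p) (xs ! i) * hy (ys ! i) = form_eval d (snd p) (xs ! i) * hx (ys ! i))"
  by (auto simp: fiber_def list_eq_iff_nth_eq pair_eval_eq_iff)

section \<open>Invariance of fiber sizes under linear changes of the values\<close>

definition gl2_act :: "'a::field \<Rightarrow> 'a \<Rightarrow> 'a \<Rightarrow> 'a \<Rightarrow> 'a poly \<times> 'a poly \<Rightarrow> 'a poly \<times> 'a poly" where
  "gl2_act a b c e p = (smult a (fst p) + smult b (snd p), smult c (fst p) + smult e (snd p))"

text \<open>The adjugate inverts the matrix up to its determinant. Injectivity of the action and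
  preservation of coprimality and exact degree all follow from this identity.\<close>

lemma gl2_act_adjugate:
  "gl2_act e (-b) (-c) a (gl2_act a b c e p) =
     (smult (a * e - b * c) (fst p), smult (a * e - b * c) (snd p))"
  by (simp add: gl2_act_def prod_eq_iff smult_add_right algebra_simps smult_diff_left)

lemma inj_gl2_act: "a * e - b * c \<noteq> 0 \<Longrightarrow> inj (gl2_act a b c e)"
proof (rule injI)
  fix p p' assume det: "a * e - b * c \<noteq> 0" and "gl2_act a b c e p = gl2_act a b c e p'"
  then have "gl2_act e (-b) (-c) a (gl2_act a b c e p) = gl2_act e (-b) (-c) a (gl2_act a b c e p')"
    by simp
  then show "p = p'"
    unfolding gl2_act_adjugate using det
    by (simp only: prod.inject poly_eq_iff coeff_smult mult_cancel_left prod_eq_iff) simp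
qed

lemma degree_gl2_act_le:
  assumes "degree (fst p) \<le> d" "degree (snd p) \<le> d"
  shows "degree (fst (gl2_act a b c e p)) \<le> d" "degree (snd (gl2_act a b c e p)) \<le> d"
  using assms by (auto simp: gl2_act_def intro!: degree_add_le intro: order.trans[OF degree_smult_le])

lemma dvd_gl2_act:
  assumes "r dvd fst p" "r dvd snd p"
  shows "r dvd fst (gl2_act a b c e p)" "r dvd snd (gl2_act a b c e p)"
  using assms by (auto simp: gl2_act_def intro!: dvd_add dvd_smult)

lemma gl2_act_coprime_pairs:
  assumes det: "a * e - b * c \<noteq> 0" and p: "p \<in> coprime_pairs d"
  shows "gl2_act a b c e p \<in> coprime_pairs d"
proof -
  let ?p' = "gl2_act a b c e p"
  have cop: "coprime (fst p) (snd p)" and deg: "max (degree (fst p)) (degree (snd p)) = d"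
    using p by (auto simp: coprime_pairs_def)
  have adj: "fst (gl2_act e (-b) (-c) a ?p') = smult (a * e - b * c) (fst p)"
             "snd (gl2_act e (-b) (-c) a ?p') = smult (a * e - b * c) (snd p)"
    by (simp_all only: gl2_act_adjugate fst_conv snd_conv)
  have "coprime (fst ?p') (snd ?p')"
  proof (rule coprimeI)
    fix r assume "r dvd fst ?p'" "r dvd snd ?p'"
    from dvd_gl2_act[OF this, of e "-b" "-c" a] have "r dvd fst p" "r dvd snd p"
      unfolding adj by (blast intro: dvd_smult_cancel[OF _ det])+
    with cop show "is_unit r"
      by (rule coprime_common_divisor)
  qed
  moreover have "max (degree (fst ?p')) (degree (snd ?p')) = d"
  proof (rule antisym)
    show "max (degree (fst ?p')) (degree (snd ?p')) \<le> d"
      using degree_gl2_act_le[of p d a b c e] deg by auto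
    show "d \<le> max (degree (fst ?p')) (degree (snd ?p'))"
      using degree_gl2_act_le[of ?p' "max (degree (fst ?p')) (degree (snd ?p'))" e "-b" "-c" a,
        OF max.cobounded1 max.cobounded2] deg det
      unfolding adj by (simp only: degree_smult_eq if_False max.bounded_iff)
  qed
  ultimately show ?thesis
    by (simp add: coprime_pairs_def split_beta)
qed

text \<open>The hypothesis \<open>M\<close> says that the matrix carries the coordinates of
  \<open>ys ! i\<close> to those of \<open>zs ! i\<close>, with \<open>s i\<close> absorbing the
  projective scaling. Up to \<open>s i\<close>, the determinant that expresses a value condition is
  then multiplied by \<open>a * e - b * c\<close>.\<close>

lemma gl2_act_fiber:
  assumes det: "a * e - b * c \<noteq> 0" and len: "length zs = length ys"
    and M: "\<And>i. i < length ys \<Longrightarrow> s i \<noteq> 0 \<and>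
              a * hx (ys ! i) + b * hy (ys ! i) = s i * hx (zs ! i) \<and>
              c * hx (ys ! i) + e * hy (ys ! i) = s i * hy (zs ! i)"
    and p: "p \<in> fiber d xs ys"
  shows "gl2_act a b c e p \<in> fiber d xs zs"
proof -
  have "form_eval d (fst (gl2_act a b c e p)) (xs ! i) * hy (zs ! i)
      = form_eval d (snd (gl2_act a b c e p)) (xs ! i) * hx (zs ! i)" if i: "i < length ys" for i
  proof -
    let ?u = "form_eval d (fst p) (xs ! i)" and ?v = "form_eval d (snd p) (xs ! i)"
    have uv: "?u * hy (ys ! i) = ?v * hx (ys ! i)"
      using p i by (auto simp: mem_fiber_iff)
    have "s i * ((a * ?u + b * ?v) * hy (zs ! i) - (c * ?u + e * ?v) * hx (zs ! i))
        = (a * ?u + b * ?v) * (s i * hy (zs ! i)) - (c * ?u + e * ?v) * (s i * hx (zs ! i))"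
      by (simp add: algebra_simps)
    also have "\<dots> = (a * ?u + b * ?v) * (c * hx (ys ! i) + e * hy (ys ! i))
        - (c * ?u + e * ?v) * (a * hx (ys ! i) + b * hy (ys ! i))"
      using M[OF i] by simp
    also have "\<dots> = (a * e - b * c) * (?u * hy (ys ! i) - ?v * hx (ys ! i))"
      by (simp add: algebra_simps)
    also have "\<dots> = 0"
      using uv by simp
    finally show ?thesis
      using M[OF i] by (simp add: gl2_act_def)
  qed
  then show ?thesis
    using p len gl2_act_coprime_pairs[OF det] by (simp add: mem_fiber_iff)
qed

lemma card_fiber_gl2:
  fixes ys zs :: "'a::finite_field proj_line list"
  assumes det: "a * e - b * c \<noteq> 0" and len: "length zs = length ys"
    and M: "\<And>i. i < length ys \<Longrightarrow> s i \<noteq> 0 \<and>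
              a * hx (ys ! i) + b * hy (ys ! i) = s i * hx (zs ! i) \<and>
              c * hx (ys ! i) + e * hy (ys ! i) = s i * hy (zs ! i)"
  shows "card (fiber d xs ys) = card (fiber d xs zs)"
proof (rule antisym)
  have "gl2_act a b c e ` fiber d xs ys \<subseteq> fiber d xs zs"
    using gl2_act_fiber[OF det len M] by blast
  then show "card (fiber d xs ys) \<le> card (fiber d xs zs)"
    using inj_gl2_act[OF det] finite_fiber by (metis card_inj_on_le inj_on_subset subset_UNIV)
  have det': "e * a - (- b) * (- c) \<noteq> 0"
    using det by (simp add: mult.commute)
  \<comment> \<open>The adjugate sends \<open>s i\<close> times the coordinates of
    \<open>zs ! i\<close> to \<open>a * e - b * c\<close> times those of \<open>ys ! i\<close>,
    whence this scalar.\<close>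
  let ?t = "\<lambda>i. (a * e - b * c) / s i"
  have M': "?t i \<noteq> 0 \<and> e * hx (zs ! i) + (- b) * hy (zs ! i) = ?t i * hx (ys ! i) \<and>
      (- c) * hx (zs ! i) + a * hy (zs ! i) = ?t i * hy (ys ! i)" if "i < length zs" for i
  proof -
    have i: "i < length ys"
      using that len by simp
    note m = M[OF i]
    have "s i * (e * hx (zs ! i) + (- b) * hy (zs ! i)) = e * (s i * hx (zs ! i)) - b * (s i * hy (zs ! i))"
      by (simp add: algebra_simps)
    also have "\<dots> = e * (a * hx (ys ! i) + b * hy (ys ! i)) - b * (c * hx (ys ! i) + e * hy (ys ! i))"
      using m by simp
    also have "\<dots> = (a * e - b * c) * hx (ys ! i)"
      by (simp add: algebra_simps)
    finally have 1: "s i * (e * hx (zs ! i) + (- b) * hy (zs ! i)) = (a * e - b * c) * hx (ys ! i)" .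
    have "s i * ((- c) * hx (zs ! i) + a * hy (zs ! i)) = a * (s i * hy (zs ! i)) - c * (s i * hx (zs ! i))"
      by (simp add: algebra_simps)
    also have "\<dots> = a * (c * hx (ys ! i) + e * hy (ys ! i)) - c * (a * hx (ys ! i) + b * hy (ys ! i))"
      using m by simp
    also have "\<dots> = (a * e - b * c) * hy (ys ! i)"
      by (simp add: algebra_simps)
    finally have 2: "s i * ((- c) * hx (zs ! i) + a * hy (zs ! i)) = (a * e - b * c) * hy (ys ! i)" .
    show ?thesis
      using 1 2 m det by (simp add: field_simps)
  qed
  have "gl2_act e (-b) (-c) a ` fiber d xs zs \<subseteq> fiber d xs ys"
    using gl2_act_fiber[OF det' len[symmetric] M'] by blast
  then show "card (fiber d xs zs) \<le> card (fiber d xs ys)"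
    using inj_gl2_act[OF det'] finite_fiber by (metis card_inj_on_le inj_on_subset subset_UNIV)
qed

text \<open>Three distinct points are the images of \<open>(1 : 0)\<close>, \<open>(0 : 1)\<close> and \<open>(1 : 1)\<close> under the matrix whose
  columns are their coordinate vectors, rescaled by Cramer's rule so that the third relation holds.\<close>

lemma card_fiber_frame:
  fixes zs :: "'a::finite_field proj_line list"
  assumes "length zs = 3" "distinct zs" "k \<le> 3"
  shows "card (fiber d xs (take k [None, Some 0, Some 1])) = card (fiber d xs (take k zs))"
proof -
  obtain z1 z2 z3 where zs: "zs = [z1, z2, z3]"
    using assms(1) by (auto simp: numeral_3_eq_3 length_Suc_conv)
  define D :: "'a proj_line \<Rightarrow> 'a proj_line \<Rightarrow> 'a" where "D \<alpha> \<beta> = hx \<alpha> * hy \<beta> - hy \<alpha> * hx \<beta>" for \<alpha> \<beta>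
  have D: "D \<alpha> \<beta> \<noteq> 0 \<longleftrightarrow> \<alpha> \<noteq> \<beta>" for \<alpha> \<beta>
    using hx_hy_eq_iff[of \<alpha> \<beta>] by (simp add: D_def)
  have nz: "D z3 z2 \<noteq> 0" "D z1 z3 \<noteq> 0" "D z1 z2 \<noteq> 0"
    using assms(2) by (auto simp: zs D)
  define s where "s i = (if i = 0 then D z3 z2 else if i = 1 then D z1 z3 else D z1 z2)" for i :: nat
  show ?thesis
  proof (rule card_fiber_gl2[of "D z3 z2 * hx z1" "D z1 z3 * hy z2" "D z1 z3 * hx z2" "D z3 z2 * hy z1" _ _ s])
    have "D z3 z2 * hx z1 * (D z1 z3 * hy z2) - D z1 z3 * hx z2 * (D z3 z2 * hy z1)
        = D z3 z2 * D z1 z3 * D z1 z2"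
      by (simp add: D_def algebra_simps)
    with nz show "D z3 z2 * hx z1 * (D z1 z3 * hy z2) - D z1 z3 * hx z2 * (D z3 z2 * hy z1) \<noteq> 0"
      by simp
    show "length (take k zs) = length (take k [None, Some 0, Some (1::'a)])"
      by (simp add: zs)
  next
    fix i assume "i < length (take k [None, Some 0, Some (1::'a)])"
    then have "i < k" and "i = 0 \<or> i = 1 \<or> i = 2"
      using assms(3) by auto
    moreover have "D z3 z2 * hx z1 + D z1 z3 * hx z2 = D z1 z2 * hx z3"
      "D z3 z2 * hy z1 + D z1 z3 * hy z2 = D z1 z2 * hy z3"
      by (simp_all add: D_def algebra_simps)
    ultimately show "s i \<noteq> 0 \<and>
      D z3 z2 * hx z1 * hx (take k [None, Some 0, Some 1] ! i) +
      D z1 z3 * hx z2 * hy (take k [None, Some 0, Some 1] ! i) = s i * hx (take k zs ! i) \<and>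
      D z3 z2 * hy z1 * hx (take k [None, Some 0, Some 1] ! i) +
      D z1 z3 * hy z2 * hy (take k [None, Some 0, Some 1] ! i) = s i * hy (take k zs ! i)"
      using nz by (elim disjE) (simp_all add: zs s_def)
  qed
qed

lemma card_fiber_eq:
  fixes ys zs :: "'a::finite_field proj_line list"
  assumes "distinct ys" "distinct zs" "length ys = k" "length zs = k" "k \<le> 3"
  shows "card (fiber d xs ys) = card (fiber d xs zs)"
proof -
  have "card (fiber d xs (take k [None, Some 0, Some 1])) = card (fiber d xs ws)"
    if ws: "distinct ws" "length ws = k" for ws :: "'a proj_line list"
  proof -
    \<comment> \<open>Lists shorter than three are prolonged by the remaining points; the projective
      line has at least three points in all.\<close>
    obtain us where us: "set us = - set ws" "distinct us"
      using finite_distinct_list[of "- set ws"] by auto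
    have 1: "distinct (ws @ us)"
      using ws us by auto
    have "set (ws @ us) = UNIV"
      using us by auto
    then have "length (ws @ us) = CARD('a proj_line)"
      using distinct_card[OF 1] by simp
    also have "\<dots> = Suc (CARD('a))"
      by simp
    finally have "length (take 3 (ws @ us)) = 3"
      using card_mono[of UNIV "{0, 1 :: 'a}"] by simp
    then have "card (fiber d xs (take k [None, Some 0, Some 1])) =
        card (fiber d xs (take k (take 3 (ws @ us))))"
      using 1 assms(5) by (intro card_fiber_frame distinct_take)
    also have "take k (take 3 (ws @ us)) = ws"
      using ws assms(5) by (simp add: min_absorb1)
    finally show ?thesis .
  qed
  from this[of ys] this[of zs] assms show ?thesis
    by simp
qed

definition distinct_lists :: "nat \<Rightarrow> 'a list set" where
  "distinct_lists k = {xs. length xs = k \<and> distinct xs}"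

lemma finite_distinct_lists [simp]: "finite (distinct_lists k :: 'a::finite list set)"
  unfolding distinct_lists_def
  by (rule finite_subset[OF _ finite_lists_length_eq[of UNIV k]]) auto

text \<open>Fibers over different target lists are disjoint, since a pair determines its values at
  \<open>xs\<close>.\<close>

lemma sum_card_fiber_le:
  fixes xs :: "'a::finite_field proj_line list"
  assumes "finite Y"
  shows "(\<Sum>ys\<in>Y. card (fiber d xs ys)) \<le> card (coprime_pairs d :: ('a poly \<times> 'a poly) set)"
proof -
  have "(\<Sum>ys\<in>Y. card (fiber d xs ys)) = card (\<Union>ys\<in>Y. fiber d xs ys)"
    using assms finite_fiber by (intro card_UN_disjoint[symmetric]) (auto simp: fiber_def)
  also have "\<dots> \<le> card (coprime_pairs d :: ('a poly \<times> 'a poly) set)"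
    by (intro card_mono finite_coprime_pairs) (auto simp: fiber_def)
  finally show ?thesis .
qed

text \<open>All fibers over distinct target lists of length at most three have the same size, and
  together they fit into the set of coprime pairs.\<close>

lemma card_fiber_short:
  fixes xs ys :: "'a::finite_field proj_line list"
  assumes "k \<le> 3" "distinct ys" "length ys = k"
  shows "card (distinct_lists k :: 'a proj_line list set) * card (fiber d xs ys)
           \<le> card (coprime_pairs d :: ('a poly \<times> 'a poly) set)"
proof -
  have "card (distinct_lists k :: 'a proj_line list set) * card (fiber d xs ys) =
      (\<Sum>zs\<in>distinct_lists k. card (fiber d xs zs))"
  proof -
    have "card (fiber d xs zs) = card (fiber d xs ys)" if "zs \<in> distinct_lists k" for zs
      using that assms by (intro card_fiber_eq) (auto simp: distinct_lists_def)
    then show ?thesis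
      by simp
  qed
  also have "\<dots> \<le> card (coprime_pairs d :: ('a poly \<times> 'a poly) set)"
    by (rule sum_card_fiber_le) simp
  finally show ?thesis .
qed

subsection \<open>Functions with many prescribed values\<close>

lemma card_degree_le_polys:
  "card {F :: 'a::{finite,comm_ring_1} poly. degree F \<le> d} \<le> CARD('a) ^ Suc d"
  and finite_degree_le_polys: "finite {F :: 'a poly. degree F \<le> d}"
proof -
  have sub: "{F :: 'a poly. degree F \<le> d} \<subseteq> Poly ` {xs. set xs \<subseteq> UNIV \<and> length xs = Suc d}"
  proof
    fix F :: "'a poly" assume "F \<in> {F. degree F \<le> d}"
    then have "F = Poly (map (coeff F) [0..<Suc d])"
      by (intro poly_eqI) (auto simp: nth_default_def coeff_eq_0 simp del: upt_Suc)
    then show "F \<in> Poly ` {xs. set xs \<subseteq> UNIV \<and> length xs = Suc d}"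
      by (intro image_eqI[of _ _ "map (coeff F) [0..<Suc d]"]) auto
  qed
  have fin: "finite {xs :: 'a list. set xs \<subseteq> UNIV \<and> length xs = Suc d}"
    by (rule finite_lists_length_eq) simp
  from sub fin show "finite {F :: 'a poly. degree F \<le> d}"
    by (blast intro: finite_subset)
  have "card {F :: 'a poly. degree F \<le> d} \<le> card {xs :: 'a list. set xs \<subseteq> UNIV \<and> length xs = Suc d}"
    using sub fin by (rule surj_card_le[rotated])
  also have "\<dots> = CARD('a) ^ Suc d"
    by (rule card_lists_length_eq) simp
  finally show "card {F :: 'a poly. degree F \<le> d} \<le> CARD('a) ^ Suc d" .
qed

text \<open>The linear relaxation of \<open>fiber\<close>: without coprimality and exact degree, the
  pairs form a vector space cut out by one equation per point.\<close>

definition interpolants :: "nat \<Rightarrow> ('a::field proj_line \<times> 'a proj_line) list \<Rightarrow> ('a poly \<times> 'a poly) set" where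
  "interpolants d ps = {p. degree (fst p) \<le> d \<and> degree (snd p) \<le> d \<and>
     (\<forall>(\<alpha>, \<beta>)\<in>set ps. form_eval d (fst p) \<alpha> * hy \<beta> = form_eval d (snd p) \<alpha> * hx \<beta>)}"

lemma finite_interpolants: "finite (interpolants d ps :: ('a::finite_field poly \<times> 'a poly) set)"
  by (rule finite_subset[of _ "{F. degree F \<le> d} \<times> {F. degree F \<le> d}"])
     (auto simp: interpolants_def finite_degree_le_polys)

text \<open>The form is a product of linear forms through the points of \<open>A\<close>, filled up
  by a form of the remaining degree that is nonzero at \<open>\<alpha>\<close>.\<close>

lemma separating_form:
  assumes "finite A" "card A \<le> d" "\<alpha> \<notin> A"
  shows "\<exists>H :: 'a::field poly. degree H \<le> d \<and> (\<forall>\<beta>\<in>A. form_eval d H \<beta> = 0) \<and> form_eval d H \<alpha> \<noteq> 0"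
  using assms
proof (induction A arbitrary: d rule: finite_induct)
  case empty
  show ?case
  proof (cases \<alpha>)
    case None
    then show ?thesis
      by (intro exI[of _ "monom 1 d"]) (simp add: degree_monom_eq)
  next
    case (Some a)
    then show ?thesis
      by (intro exI[of _ 1]) simp
  qed
next
  case (insert x A)
  then obtain d' where d: "d = Suc d'"
    by (cases d) auto
  then obtain H where H: "degree H \<le> d'" "\<forall>\<beta>\<in>A. form_eval d' H \<beta> = 0" "form_eval d' H \<alpha> \<noteq> 0"
    using insert by auto
  show ?case
  proof (cases x)
    case None
    \<comment> \<open>The linear form vanishing at infinity dehomogenizes to 1: the same
      \<open>H\<close>, regarded in degree one higher, acquires a zero there.\<close>
    then have "form_eval d H \<beta> = 0" if "\<beta> \<in> insert x A" for \<beta>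
      using that H d by (cases \<beta>) (auto simp: coeff_eq_0)
    moreover have "form_eval d H \<alpha> \<noteq> 0"
      using H insert.prems None by (cases \<alpha>) auto
    ultimately show ?thesis
      using H d by (intro exI[of _ H]) auto
  next
    case (Some a)
    have ev: "form_eval d (H * [:-a, 1:]) \<beta> = form_eval d' H \<beta> * (case \<beta> of None \<Rightarrow> 1 | Some b \<Rightarrow> b - a)" for \<beta>
      using H(1) d by (cases \<beta>) (auto simp: algebra_simps coeff_eq_0)
    have "form_eval d (H * [:-a, 1:]) \<beta> = 0" if "\<beta> \<in> insert x A" for \<beta>
      using that H Some unfolding ev by auto
    moreover have "form_eval d (H * [:-a, 1:]) \<alpha> \<noteq> 0"
      using H insert.prems Some unfolding ev by (cases \<alpha>) auto
    moreover have "degree (H * [:-a, 1:]) \<le> d"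
      using degree_mult_le[of H "[:-a, 1:]"] H d by simp
    ultimately show ?thesis
      by blast
  qed
qed

text \<open>The witness is \<open>H\<close> times the coordinates of the first target \<open>\<gamma>\<close>: it meets the first condition
  for any \<open>H\<close>, so \<open>H\<close> only has to vanish at the other at most \<open>d\<close> sources. This is why \<open>d + 2\<close> conditions
  are independent, one more than for interpolation by a single form.\<close>

lemma interpolants_witness:
  assumes "distinct (\<alpha> # map fst ps)" "distinct (\<beta> # map snd ps)" "length ps \<le> Suc d"
  shows "\<exists>w\<in>interpolants d ps. form_eval d (fst w) \<alpha> * hy \<beta> \<noteq> form_eval d (snd w) \<alpha> * hx (\<beta> :: 'a::field proj_line)"
proof -
  obtain \<gamma> A where \<gamma>: "\<gamma> \<noteq> \<beta>" and A: "finite A" "card A \<le> d" "\<alpha> \<notin> A" "\<forall>(x, y)\<in>set ps. x \<in> A \<or> y = \<gamma>"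
  proof (cases ps)
    case Nil
    have "(if \<beta> = None then Some 0 else None) \<noteq> \<beta>"
      by auto
    then show ?thesis
      by (rule that[of _ "{}"]) (simp_all add: Nil)
  next
    case (Cons p qs)
    show ?thesis
    proof (rule that[of "snd p" "set (map fst qs)"])
      show "card (set (map fst qs)) \<le> d"
        using assms(3) Cons card_length[of "map fst qs"] by simp
      show "snd p \<noteq> \<beta>" "\<alpha> \<notin> set (map fst qs)"
        using assms(1,2) Cons by auto
      show "\<forall>(x, y)\<in>set ps. x \<in> set (map fst qs) \<or> y = snd p"
        by (auto simp: Cons intro: rev_image_eqI)
    qed simp
  qed
  then obtain H where H: "degree H \<le> d" "\<forall>x\<in>A. form_eval d H x = 0" "form_eval d H \<alpha> \<noteq> 0"
    using separating_form[OF A(1-3)] by blast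
  let ?w = "(smult (hx \<gamma>) H, smult (hy \<gamma>) H)"
  have "?w \<in> interpolants d ps"
    using H A(4) by (auto simp: interpolants_def intro: order.trans[OF degree_smult_le])
  moreover have "form_eval d H \<alpha> * (hx \<gamma> * hy \<beta>) \<noteq> form_eval d H \<alpha> * (hy \<gamma> * hx \<beta>)"
    using \<gamma> H(3) by (simp add: hx_hy_eq_iff)
  then have "form_eval d (fst ?w) \<alpha> * hy \<beta> \<noteq> form_eval d (snd ?w) \<alpha> * hx \<beta>"
    by (simp add: algebra_simps)
  ultimately show ?thesis
    by blast
qed

text \<open>Each condition costs a factor \<open>q\<close>. Adding multiples of a \<open>w\<close>
  that meets the old conditions but violates the new one embeds
  \<open>interpolants d (p # ps) \<times> UNIV\<close> into \<open>interpolants d ps\<close>; the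
  multiple is recovered by evaluating the new condition.\<close>

lemma card_interpolants:
  fixes ps :: "('a::finite_field proj_line \<times> 'a proj_line) list"
  assumes "distinct (map fst ps)" "distinct (map snd ps)" "length ps \<le> d + 2"
  shows "card (interpolants d ps) * CARD('a) ^ length ps \<le> CARD('a) ^ (2 * d + 2)"
  using assms
proof (induction ps)
  case Nil
  have "interpolants d ([] :: ('a proj_line \<times> 'a proj_line) list) = {F. degree F \<le> d} \<times> {F. degree F \<le> d}"
    by (auto simp: interpolants_def)
  then have "card (interpolants d ([] :: ('a proj_line \<times> 'a proj_line) list)) \<le> CARD('a) ^ Suc d * CARD('a) ^ Suc d"
    using mult_le_mono[OF card_degree_le_polys card_degree_le_polys, where ?'a1 = 'a and ?'a2 = 'a] 
    by (simp only: card_cartesian_product)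
  moreover have "2 * d + 2 = Suc d + Suc d"
    by simp
  ultimately show ?case
    by (simp only: power_add list.size power_0 mult_1_right)
next
  case (Cons p ps)
  obtain \<alpha> \<beta> where p: "p = (\<alpha>, \<beta>)"
    by (cases p)
  obtain w where w: "w \<in> interpolants d ps" "form_eval d (fst w) \<alpha> * hy \<beta> \<noteq> form_eval d (snd w) \<alpha> * hx \<beta>"
    using interpolants_witness[of \<alpha> ps \<beta> d] Cons.prems p by auto
  define \<phi> where "\<phi> v = form_eval d (fst v) \<alpha> * hy \<beta> - form_eval d (snd v) \<alpha> * hx \<beta>" for v :: "'a poly \<times> 'a poly"
  define T where "T = (\<lambda>(v :: 'a poly \<times> 'a poly, c). (fst v + smult c (fst w), snd v + smult c (snd w)))"
  have \<phi>: "\<phi> (T (v, c)) = \<phi> v + c * \<phi> w" for v c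
    by (simp add: \<phi>_def T_def algebra_simps)
  have \<phi>0: "\<phi> v = 0" if "v \<in> interpolants d (p # ps)" for v
    using that by (simp add: \<phi>_def interpolants_def p)
  have w0: "\<phi> w \<noteq> 0"
    using w by (simp add: \<phi>_def)
  have "inj_on T (interpolants d (p # ps) \<times> UNIV)"
  proof (rule inj_onI)
    fix x y assume x: "x \<in> interpolants d (p # ps) \<times> UNIV" and y: "y \<in> interpolants d (p # ps) \<times> UNIV"
      and eq: "T x = T y"
    have "snd x * \<phi> w = snd y * \<phi> w"
      using \<phi>[of "fst x" "snd x"] \<phi>[of "fst y" "snd y"] x y eq \<phi>0 by auto
    with w0 have "snd x = snd y"
      by simp
    with eq show "x = y"
      by (auto simp: T_def prod_eq_iff split_beta)
  qed
  moreover have "T ` (interpolants d (p # ps) \<times> UNIV) \<subseteq> interpolants d ps"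
  proof
    fix x assume "x \<in> T ` (interpolants d (p # ps) \<times> UNIV)"
    then obtain v c where "v \<in> interpolants d (p # ps)" "x = T (v, c)"
      by auto
    with w(1) show "x \<in> interpolants d ps"
      by (auto simp: interpolants_def T_def algebra_simps split_beta
          intro!: degree_add_le order.trans[OF degree_smult_le])
  qed
  ultimately have "card (interpolants d (p # ps)) * CARD('a) \<le> card (interpolants d ps)"
    using card_inj_on_le[OF _ _ finite_interpolants] by (metis card_cartesian_product)
  then have "card (interpolants d (p # ps)) * CARD('a) * CARD('a) ^ length ps
      \<le> card (interpolants d ps) * CARD('a) ^ length ps"
    by (rule mult_le_mono1)
  also have "\<dots> \<le> CARD('a) ^ (2 * d + 2)"
    using Cons by simp
  finally show ?case
    by (simp add: mult.assoc)
qed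

lemma card_fiber_le:
  fixes xs ys :: "'a::finite_field proj_line list"
  assumes "distinct xs" "distinct ys" "length xs = k" "length ys = k" "k \<le> d + 2"
  shows "card (fiber d xs ys) * CARD('a) ^ k \<le> CARD('a) ^ (2 * d + 2)"
proof -
  have "fiber d xs ys \<subseteq> interpolants d (zip xs ys)"
    using assms by (auto simp: mem_fiber_iff interpolants_def coprime_pairs_def set_zip)
  then have "card (fiber d xs ys) \<le> card (interpolants d (zip xs ys))"
    by (intro card_mono finite_interpolants)
  then have "card (fiber d xs ys) * CARD('a) ^ k \<le> card (interpolants d (zip xs ys)) * CARD('a) ^ k"
    by (rule mult_le_mono1)
  also have "\<dots> \<le> CARD('a) ^ (2 * d + 2)"
    using card_interpolants[of "zip xs ys" d] assms by simp
  finally show ?thesis .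
qed

subsection \<open>The number of rational functions\<close>

text \<open>For \<open>d > 0\<close> these represent the functions that fix infinity.\<close>

definition pole_pairs :: "nat \<Rightarrow> ('a::field poly \<times> 'a poly) set" where
  "pole_pairs d = {(F, G). coprime F G \<and> degree F = d \<and> degree G < d}"

lemma pole_pairs_nonzero: "(F, G) \<in> pole_pairs d \<Longrightarrow> G \<noteq> 0"
  using is_unit_iff_degree[of F] by (cases "F = 0") (auto simp: pole_pairs_def)

lemma fiber_infinity_infinity: "d > 0 \<Longrightarrow> fiber d [None] [None] = pole_pairs d"
proof -
  assume "d > 0"
  then have "degree G = d \<Longrightarrow> coeff G d \<noteq> 0" for G :: "'a::field poly"
    by auto
  then have "(degree F \<le> d \<and> degree G \<le> d \<and> (degree F = d \<or> degree G = d) \<and> coeff G d = 0)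
      = (degree F = d \<and> degree G < d)" for F G :: "'a poly"
    by (auto simp: coeff_eq_0 le_less)
  moreover have "max m n = d \<longleftrightarrow> m \<le> d \<and> n \<le> d \<and> (m = d \<or> n = d)" for m n
    by auto
  ultimately show ?thesis
    by (auto simp: mem_fiber_iff coprime_pairs_def pole_pairs_def coeff_eq_0)
qed

lemma finite_pole_pairs: "d > 0 \<Longrightarrow> finite (pole_pairs d :: ('a::finite_field poly \<times> 'a poly) set)"
  using finite_fiber fiber_infinity_infinity by metis

text \<open>By transitivity on single values, each of the \<open>q + 1\<close> values at infinity is
  taken by equally many pairs, and the pole pairs take the value infinity.\<close>

lemma card_coprime_pairs:
  assumes "d > 0"
  shows "card (coprime_pairs d :: ('a::finite_field poly \<times> 'a poly) set)
      \<ge> Suc (CARD('a)) * card (pole_pairs d :: ('a poly \<times> 'a poly) set)"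
proof -
  have "(distinct_lists 1 :: 'a proj_line list set) = (\<lambda>x. [x]) ` UNIV"
    by (auto simp: distinct_lists_def length_Suc_conv)
  then have "card (distinct_lists 1 :: 'a proj_line list set) = CARD('a proj_line)"
    using card_image[of "\<lambda>x :: 'a proj_line. [x]" UNIV] by (simp add: inj_on_def)
  also have "\<dots> = Suc (CARD('a))"
    by simp
  finally have "card (distinct_lists 1 :: 'a proj_line list set) = Suc (CARD('a))" .
  then show ?thesis
    using card_fiber_short[of 1 "[None :: 'a proj_line]" d "[None]"] assms by (simp add: fiber_infinity_infinity)
qed

text \<open>In the continued fraction of \<open>F / G\<close>, either the leading quotient \<open>F div G\<close> is replaced by
  \<open>x (F div G) + b\<close>, or a new linear quotient \<open>a x + b\<close> with \<open>a \<noteq> 0\<close> is put in front of it.\<close>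

lemma card_pole_pairs_Suc:
  assumes "d > 0"
  shows "card (pole_pairs (Suc d) :: ('a::finite_field poly \<times> 'a poly) set)
      \<ge> card (pole_pairs d :: ('a poly \<times> 'a poly) set) * CARD('a)\<^sup>2"
proof -
  define T :: "('a poly \<times> 'a poly) \<times> 'a \<times> 'a \<Rightarrow> 'a poly \<times> 'a poly" where
    "T = (\<lambda>((F, G), a, b). if a = 0 then (pCons b (F div G) * G + F mod G, G) else ([:b, a:] * F + G, F))"
  have "inj_on T (pole_pairs d \<times> UNIV)"
  proof (rule inj_onI)
    fix x y assume xy: "x \<in> pole_pairs d \<times> UNIV" "y \<in> pole_pairs d \<times> UNIV" "T x = T y"
    obtain F G a b F' G' a' b' where x: "x = ((F, G), a, b)" and y: "y = ((F', G'), a', b')"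
      by (cases x, cases y) auto
    have FG: "degree F = d" "degree G < d" "degree F' = d" "degree G' < d" "G \<noteq> 0" "G' \<noteq> 0" "F \<noteq> 0" "F' \<noteq> 0"
      using xy(1,2) assms pole_pairs_nonzero by (auto simp: x y pole_pairs_def)
    note T_eq = xy(3)[unfolded x y T_def split]
    \<comment> \<open>Dividing by the second component of the image undoes either branch, because
      the term added has smaller degree and so is the remainder.\<close>
    have divmod: "(P * G + F mod G) div G = P" "(P * G + F mod G) mod G = F mod G"
      "(P * G' + F' mod G') div G' = P" "(P * G' + F' mod G') mod G' = F' mod G'"
      "(P * F + G) div F = P" "(P * F + G) mod F = G"
      "(P * F' + G') div F' = P" "(P * F' + G') mod F' = G'" for P
      using FG by (simp_all add: div_poly_less mod_poly_less)
    show "x = y"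
    \<comment> \<open>The mixed cases cannot occur: the second component of the image has degree
      below \<open>d\<close> in one branch and exactly \<open>d\<close> in the other.\<close>
    proof (cases "a = 0"; cases "a' = 0")
      assume a: "a = 0" "a' = 0"
      with T_eq have G: "G = G'" and "pCons b (F div G) * G + F mod G = pCons b' (F' div G) * G + F' mod G"
        by auto
      then have "pCons b (F div G) = pCons b' (F' div G)" "F mod G = F' mod G"
        using divmod by metis+
      then show ?thesis
        using a G by (metis div_mult_mod_eq pCons_eq_iff x y)
    next
      assume a: "a \<noteq> 0" "a' \<noteq> 0"
      with T_eq have F: "F = F'" and "[:b, a:] * F + G = [:b', a':] * F + G'"
        by auto
      then have "[:b, a:] = [:b', a':]" "G = G'"
        using divmod by metis+
      then show ?thesis
        using F x y by simp
    qed (use T_eq FG in auto)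
  qed
  moreover have "T ` (pole_pairs d \<times> UNIV) \<subseteq> pole_pairs (Suc d)"
  proof
    fix z assume "z \<in> T ` (pole_pairs d \<times> UNIV)"
    then obtain F G a b where z: "z = T ((F, G), a, b)" and FG: "(F, G) \<in> pole_pairs d"
      by auto
    then have deg: "degree F = d" "degree G < d" "G \<noteq> 0" "F \<noteq> 0" and cop: "coprime F G"
      using pole_pairs_nonzero assms by (auto simp: pole_pairs_def)
    show "z \<in> pole_pairs (Suc d)"
    proof (cases "a = 0")
      case True
      have "coprime (pCons b (F div G) * G + F mod G) G"
        using cop by (metis (no_types, opaque_lifting) add.commute coprime_commute coprime_mod_left_iff deg(3) mod_mult_self2 mult.commute)
      moreover have "degree (pCons b (F div G) * G + F mod G) = Suc d"
      proof -
        have R: "degree (F mod G) \<le> degree G"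
          using degree_mod_less[OF deg(3), of F] by auto
        have "F div G * G = F + - (F mod G)"
          by (simp add: minus_mod_eq_div_mult)
        also have "degree \<dots> = d"
          using R deg by (subst degree_add_eq_left) auto
        finally have "degree (F div G * G) = d" .
        moreover from this have "F div G \<noteq> 0"
          using assms by auto
        ultimately have "degree (pCons b (F div G) * G) = Suc d"
          using deg by (simp add: degree_mult_eq del: mult_pCons_left)
        with R show ?thesis
          using deg by (subst degree_add_eq_left) auto
      qed
      ultimately show ?thesis
        using True deg by (simp add: z T_def pole_pairs_def)
    next
      case False
      have "coprime ([:b, a:] * F + G) F"
        using cop by (metis (no_types, opaque_lifting) add.commute coprime_commute coprime_mod_left_iff deg(4) mod_mult_self2 mult.commute)
      moreover have "degree ([:b, a:] * F + G) = Suc d"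
      proof -
        have "degree ([:b, a:] * F) = Suc d"
          using deg False by (subst degree_mult_eq) auto
        then show ?thesis
          using deg by (simp add: degree_add_eq_left del: mult_pCons_left)
      qed
      ultimately show ?thesis
        using False deg by (simp add: z T_def pole_pairs_def del: mult_pCons_left)
    qed
  qed
  ultimately have "card ((pole_pairs d :: ('a poly \<times> 'a poly) set) \<times> (UNIV :: ('a \<times> 'a) set)) \<le> card (pole_pairs (Suc d) :: ('a poly \<times> 'a poly) set)"
    by (rule card_inj_on_le) (rule finite_pole_pairs, simp)
  then show ?thesis
    by (simp add: card_cartesian_product power2_eq_square)
qed

text \<open>The induction starts from linear polynomials over nonzero constants, which give
  \<open>(q - 1)^2 * q\<close> pairs, and each further degree contributes a factor
  \<open>q^2\<close>.\<close>

lemma card_pole_pairs: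
  "card (pole_pairs (Suc d) :: ('a::finite_field poly \<times> 'a poly) set) \<ge> (CARD('a) - 1)\<^sup>2 * CARD('a) ^ (2 * d + 1)"
proof (induction d)
  case 0
  define T :: "('a \<times> 'a) \<times> 'a \<Rightarrow> 'a poly \<times> 'a poly" where "T = (\<lambda>((a, c), b). ([:b, a:], [:c:]))"
  let ?D = "((- {0}) \<times> (- {0})) \<times> UNIV :: (('a \<times> 'a) \<times> 'a) set"
  have "card ?D \<le> card (pole_pairs 1 :: ('a poly \<times> 'a poly) set)"
  proof (rule card_inj_on_le)
    show "inj_on T ?D"
      by (auto simp: T_def inj_on_def)
    show "T ` ?D \<subseteq> pole_pairs 1"
      by (auto simp: T_def pole_pairs_def is_unit_right_imp_coprime is_unit_pCons_iff)
  qed (simp add: finite_pole_pairs)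
  then show ?case
    by (simp add: card_cartesian_product card_nonzero power2_eq_square)
next
  case (Suc d)
  have "(CARD('a) - 1)\<^sup>2 * CARD('a) ^ (2 * Suc d + 1) = (CARD('a) - 1)\<^sup>2 * CARD('a) ^ (2 * d + 1) * CARD('a)\<^sup>2"
    by (simp add: power2_eq_square mult_ac)
  also have "\<dots> \<le> card (pole_pairs (Suc d) :: ('a poly \<times> 'a poly) set) * CARD('a)\<^sup>2"
    using Suc.IH by (rule mult_le_mono1)
  also have "\<dots> \<le> card (pole_pairs (Suc (Suc d)) :: ('a poly \<times> 'a poly) set)"
    by (rule card_pole_pairs_Suc) simp
  finally show ?case .
qed

subsection \<open>Cyclic walks\<close>

lemma length_le_CARD: "distinct xs \<Longrightarrow> length xs \<le> CARD('a)" for xs :: "'a::finite list"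
  using distinct_card[of xs] card_mono[of UNIV "set xs"] by simp

lemma card_distinct_lists_Suc:
  "card (distinct_lists (Suc k) :: 'a::finite list set) = (CARD('a) - k) * card (distinct_lists k :: 'a list set)"
proof (cases "k < CARD('a)")
  case True
  have *: "card (distinct_lists j :: 'a list set) = \<Prod>{CARD('a) - j + 1..CARD('a)}" if "j \<le> CARD('a)" for j
    using card_lists_distinct_length_eq[of "UNIV :: 'a set" j] that by (simp add: distinct_lists_def)
  have "{CARD('a) - k..CARD('a)} = insert (CARD('a) - k) {CARD('a) - k + 1..CARD('a)}"
    by auto
  moreover have "CARD('a) - Suc k + 1 = CARD('a) - k"
    using True by simp
  ultimately show ?thesis
    using True by (simp add: *)
next
  case False
  then have "distinct_lists (Suc k) = ({} :: 'a list set)"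
    using length_le_CARD[where ?'a = 'a] by (fastforce simp: distinct_lists_def)
  with False show ?thesis
    by simp
qed

text \<open>The first four factors of the falling factorial are kept, and every later one,
  \<open>q + 1 - k\<close>, is at most \<open>q\<close>. For \<open>q = 2\<close> the bound is zero,
  in accordance with the three points available.\<close>

lemma card_distinct_lists_proj_line:
  assumes "k \<ge> 4"
  shows "card (distinct_lists k :: 'a::finite proj_line list set)
     \<le> Suc (CARD('a)) * CARD('a) * (CARD('a) - 1) * (CARD('a) - 2) * CARD('a) ^ (k - 4)"
  using assms
proof (induction k rule: nat_induct_at_least)
  case base
  have "distinct_lists 0 = {[] :: 'a proj_line list}"
    by (auto simp: distinct_lists_def)
  then show ?case
    by (simp add: eval_nat_numeral card_distinct_lists_Suc)
next
  case (Suc k)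
  have "card (distinct_lists (Suc k) :: 'a proj_line list set)
      = (Suc (CARD('a)) - k) * card (distinct_lists k :: 'a proj_line list set)"
    by (simp add: card_distinct_lists_Suc)
  also have "\<dots> \<le> CARD('a) * (Suc (CARD('a)) * CARD('a) * (CARD('a) - 1) * (CARD('a) - 2) * CARD('a) ^ (k - 4))"
    using Suc by (intro mult_le_mono) auto
  also have "CARD('a) * (Suc (CARD('a)) * CARD('a) * (CARD('a) - 1) * (CARD('a) - 2) * CARD('a) ^ (k - 4))
      = Suc (CARD('a)) * CARD('a) * (CARD('a) - 1) * (CARD('a) - 2) * CARD('a) ^ (Suc k - 4)"
    by (simp only: Suc_diff_le[OF Suc.hyps] power_Suc mult_ac)
  finally show ?case .
qed

lemma card_fiber_bound:
  fixes xs ys :: "'a::finite_field proj_line list"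
  assumes "distinct xs" "distinct ys" "length xs = k" "length ys = k" "k \<le> d + 2"
  shows "card (distinct_lists k :: 'a proj_line list set) * card (fiber d xs ys)
           \<le> card (coprime_pairs d :: ('a poly \<times> 'a poly) set)"
proof (cases "k \<le> 3")
  case True
  then show ?thesis
    using card_fiber_short assms by blast
next
  case False
  let ?q = "CARD('a)"
  define m where "m = k - 4"
  define e where "e = d - 1"
  \<comment> \<open>Four or more points force \<open>d \<ge> 2\<close>, so the count of pole pairs
    applies with \<open>d = Suc e\<close>.\<close>
  have k: "k = m + 4" and d: "d = Suc e"
    using False assms(5) by (auto simp: m_def e_def)
  have "card (distinct_lists k :: 'a proj_line list set) * card (fiber d xs ys) * ?q ^ k
      = card (distinct_lists k :: 'a proj_line list set) * (card (fiber d xs ys) * ?q ^ k)"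
    by simp
  also have "\<dots> \<le> (Suc ?q * ?q * (?q - 1) * (?q - 2) * ?q ^ m) * ?q ^ (2 * d + 2)"
    using card_distinct_lists_proj_line[of k] card_fiber_le[OF assms] False
    by (intro mult_le_mono) (auto simp: m_def)
  also have "\<dots> = (Suc ?q * (?q - 1) * (?q - 2) * ?q ^ (2 * e + 1)) * ?q ^ k"
    by (simp add: k d power_add mult_ac eval_nat_numeral del: mult_Suc)
  \<comment> \<open>With \<open>q^k\<close> split off, the two bounds differ only by
    \<open>q - 2 \<le> q - 1\<close>.\<close>
  also have "\<dots> \<le> (Suc ?q * ((?q - 1)\<^sup>2 * ?q ^ (2 * e + 1))) * ?q ^ k"
    unfolding power2_eq_square mult.assoc by (intro mult_le_mono order_refl diff_le_mono2) simp
  also have "\<dots> \<le> card (coprime_pairs d :: ('a poly \<times> 'a poly) set) * ?q ^ k"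
    unfolding d by (intro mult_le_mono1 order.trans[OF mult_le_mono2[OF card_pole_pairs] card_coprime_pairs]) simp
  finally show ?thesis
    by simp
qed

text \<open>A cyclic walk \<open>xs\<close> amounts to prescribing the distinct values
  \<open>rotate1 xs\<close> at the distinct points \<open>xs\<close>, which is what the fibers
  count.\<close>

lemma cyclic_walks_functional_graph:
  "cyclic_walks (functional_graph f) k = {xs \<in> distinct_lists k. map f xs = rotate1 xs}"
  by (auto simp: cyclic_walks_def functional_graph_def distinct_lists_def list_eq_iff_nth_eq nth_rotate1)

lemma finite_cyclic_walks: "finite (cyclic_walks E k :: 'v::finite list set)"
  by (rule finite_subset[OF _ finite_distinct_lists[of k]]) (auto simp: cyclic_walks_def distinct_lists_def)

text \<open>Double counting of a function together with a walk gives one fiber for each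
  \<open>xs\<close>, and each fiber has at most an average share of all coprime pairs.\<close>

lemma sum_cyclic_walks_coprime_pairs:
  assumes "k \<le> d + 2"
  shows "(\<Sum>p\<in>(coprime_pairs d :: ('a::finite_field poly \<times> 'a poly) set).
            card (cyclic_walks (functional_graph (pair_eval d p)) k))
          \<le> card (coprime_pairs d :: ('a poly \<times> 'a poly) set)"
proof -
  let ?P = "coprime_pairs d :: ('a poly \<times> 'a poly) set"
  let ?D = "distinct_lists k :: 'a proj_line list set"
  have "(\<Sum>p\<in>?P. card (cyclic_walks (functional_graph (pair_eval d p)) k))
      = (\<Sum>xs\<in>?D. card (fiber d xs (rotate1 xs)))"
    unfolding cyclic_walks_functional_graph fiber_def
    by (rule sum_multicount_gen) (simp_all add: finite_coprime_pairs)
  moreover have "card ?D * (\<Sum>xs\<in>?D. card (fiber d xs (rotate1 xs))) \<le> (\<Sum>xs\<in>?D. card ?P)"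
    unfolding sum_distrib_left
    using assms by (intro sum_mono card_fiber_bound) (auto simp: distinct_lists_def)
  \<comment> \<open>For \<open>k > q + 1\<close> there is no factor to cancel, but the sum is
    empty.\<close>
  moreover have "(\<Sum>xs\<in>?D. card (fiber d xs (rotate1 xs))) = 0" if "card ?D = 0"
    using that by simp
  ultimately show ?thesis
    by (cases "card ?D = 0") auto
qed

lemma sum_cyclic_walks_rf:
  assumes "k \<le> d + 2"
  shows "(\<Sum>f\<in>(rf_of_degree d :: 'a::finite_field ratfun set). card (cyclic_walks (functional_graph (rf_eval f)) k))
          \<le> card (rf_of_degree d :: 'a ratfun set)"
proof -
  have "(\<Sum>p\<in>(coprime_pairs d :: ('a poly \<times> 'a poly) set). 1) = (CARD('a) - 1) * (\<Sum>f\<in>(rf_of_degree d :: 'a ratfun set). 1)"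
    using sum_coprime_pairs[of "\<lambda>_ :: 'a proj_line \<Rightarrow> 'a proj_line. 1 :: nat" d] by simp
  then have "(CARD('a) - 1) * (\<Sum>f\<in>(rf_of_degree d :: 'a ratfun set). card (cyclic_walks (functional_graph (rf_eval f)) k))
      \<le> (CARD('a) - 1) * card (rf_of_degree d :: 'a ratfun set)"
    using sum_cyclic_walks_coprime_pairs[where ?'a = 'a, OF assms]
      sum_coprime_pairs[of "\<lambda>g :: 'a proj_line \<Rightarrow> 'a proj_line. card (cyclic_walks (functional_graph g) k)" d] by simp
  moreover have "CARD('a) - 1 > 0"
    using card_mono[of UNIV "{0, 1 :: 'a}"] by simp
  ultimately show ?thesis
    by simp
qed

section \<open>Cycles as rotation classes of cyclic walks\<close>

lemma card_rotations:
  assumes "distinct xs" "xs \<noteq> []"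
  shows "card {ys. \<exists>n. ys = rotate n xs} = length xs"
proof -
  have "{ys. \<exists>n. ys = rotate n xs} = (\<lambda>n. rotate n xs) ` {..<length xs}"
  proof (intro equalityI subsetI)
    fix ys assume "ys \<in> {ys. \<exists>n. ys = rotate n xs}"
    then obtain n where "ys = rotate n xs"
      by auto
    then have "ys = rotate (n mod length xs) xs"
      using rotate_conv_mod by metis
    then show "ys \<in> (\<lambda>n. rotate n xs) ` {..<length xs}"
      using assms(2) by (intro image_eqI[of _ _ "n mod length xs"]) auto
  qed auto
  moreover have "inj_on (\<lambda>n. rotate n xs) {..<length xs}"
  proof (rule inj_onI)
    fix m n assume "m \<in> {..<length xs}" "n \<in> {..<length xs}" "rotate m xs = rotate n xs"
    then have "xs ! m = xs ! n"
      using hd_rotate_conv_nth[OF assms(2)] by (metis lessThan_iff mod_less)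
    with \<open>m \<in> _\<close> \<open>n \<in> _\<close> show "m = n"
      using assms(1) by (simp add: nth_eq_iff_index_eq)
  qed
  ultimately show ?thesis
    by (simp add: card_image)
qed

lemma rotate_back: "\<exists>m. rotate m (rotate n xs) = xs"
proof (cases "xs = []")
  case False
  have "rotate (length xs - n mod length xs) (rotate n xs) = rotate ((length xs - n mod length xs + n) mod length xs) xs"
    unfolding rotate_rotate by (rule rotate_conv_mod)
  also have "(length xs - n mod length xs + n) mod length xs = 0"
  proof -
    have "(length xs - n mod length xs + n) mod length xs = (length xs - n mod length xs + n mod length xs) mod length xs"
      by (simp add: mod_add_right_eq)
    also have "length xs - n mod length xs + n mod length xs = length xs"
      using False mod_less_divisor[of "length xs" n] by (simp add: less_imp_le)
    finally show ?thesis
      by simp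
  qed
  finally show ?thesis
    by auto
qed auto

text \<open>The rotation class of a walk of length \<open>k\<close> has exactly \<open>k\<close>
  members, and the classes partition the walks.\<close>

lemma card_k_cycles:
  fixes f :: "'v::finite \<Rightarrow> 'v"
  assumes "k \<ge> 1"
  shows "k * card (k_cycles (functional_graph f) k) = card (cyclic_walks (functional_graph f) k)"
proof -
  let ?W = "cyclic_walks (functional_graph f) k"
  let ?C = "k_cycles (functional_graph f) k"
  have C: "?C = (\<lambda>xs. {ys. \<exists>n. ys = rotate n xs}) ` ?W"
    by (auto simp: k_cycles_def quotient_def)
  \<comment> \<open>Rotation commutes with applying \<open>f\<close> entrywise, so a class formed
    among all lists stays within the walks.\<close>
  have closed: "rotate n xs \<in> ?W" if "xs \<in> ?W" for n xs
    using that by (simp add: cyclic_walks_functional_graph distinct_lists_def rotate_map[symmetric] rotate1_rotate_swap)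
  have U: "\<Union>?C = ?W"
  proof (intro equalityI subsetI)
    fix ys assume "ys \<in> \<Union>?C"
    then obtain xs n where "xs \<in> ?W" "ys = rotate n xs"
      by (auto simp: C)
    then show "ys \<in> ?W"
      by (simp only: closed)
  next
    fix xs assume "xs \<in> ?W"
    moreover have "\<exists>n. xs = rotate n xs"
      by (rule exI[of _ 0]) simp
    ultimately show "xs \<in> \<Union>?C"
      by (auto simp: C)
  qed
  have "k * card ?C = card (\<Union>?C)"
  proof (rule card_partition)
    show "finite ?C" "finite (\<Union>?C)"
      using finite_cyclic_walks by (simp_all add: C finite_cyclic_walks U[unfolded C])
    show "card c = k" if "c \<in> ?C" for c
      using that assms card_rotations by (force simp: C cyclic_walks_def)
    fix c1 c2 assume "c1 \<in> ?C" "c2 \<in> ?C" "c1 \<noteq> c2"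
    then obtain xs ys where c: "c1 = {zs. \<exists>n. zs = rotate n xs}" "c2 = {zs. \<exists>n. zs = rotate n ys}"
      by (auto simp: C)
    show "c1 \<inter> c2 = {}"
    proof (rule ccontr)
      assume "c1 \<inter> c2 \<noteq> {}"
      then obtain m n where mn: "rotate m xs = rotate n ys"
        by (auto simp: c)
      obtain m' n' where "rotate m' (rotate m xs) = xs" "rotate n' (rotate n ys) = ys"
        using rotate_back by metis
      then have "xs = rotate (m' + n) ys" "ys = rotate (n' + m) xs"
        using mn by (metis rotate_rotate)+
      then have "c1 = c2"
        unfolding c by (metis rotate_rotate)
      with \<open>c1 \<noteq> c2\<close> show False
        by simp
    qed
  qed
  then show ?thesis
    by (simp only: U)
qed

text \<open>Admitting \<open>i = k\<close> records the return to the start: \<open>f ^^ k\<close>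
  fixes the head.\<close>

lemma cyclic_walk_nth:
  assumes "xs \<in> cyclic_walks (functional_graph f) k" "i \<le> k" "k > 0"
  shows "xs ! (i mod k) = (f ^^ i) (hd xs)"
  using assms(2)
proof (induction i)
  case 0
  then show ?case
    using assms by (cases xs) (auto simp: cyclic_walks_def)
next
  case (Suc i)
  have "xs ! (Suc i mod k) = f (xs ! i)"
    using assms(1) Suc.prems by (auto simp: cyclic_walks_def functional_graph_def)
  also have "xs ! i = (f ^^ i) (hd xs)"
    using Suc by simp
  finally show ?case
    by simp
qed

text \<open>A walk is the orbit of its head, so the head determines it. The one-sided bound on the
  lengths becomes equality when the roles are exchanged.\<close>

lemma cyclic_walk_eq:
  assumes "xs \<in> cyclic_walks (functional_graph f) k" "ys \<in> cyclic_walks (functional_graph f) l"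
    and "k > 0" "l > 0" "hd xs = hd ys"
  shows "k \<ge> l" "k = l \<Longrightarrow> xs = ys"
proof -
  show "k \<ge> l"
  proof (rule ccontr)
    assume "\<not> k \<ge> l"
    \<comment> \<open>If \<open>k < l\<close>, the orbit is back at its head after \<open>k\<close>
      steps, which repeats an entry of \<open>ys\<close>.\<close>
    then have "ys ! k = xs ! 0"
      using cyclic_walk_nth[OF assms(1), of k] cyclic_walk_nth[OF assms(2), of k] assms by simp
    also have "\<dots> = ys ! 0"
      using cyclic_walk_nth[OF assms(1), of 0] cyclic_walk_nth[OF assms(2), of 0] assms by simp
    finally show False
      using assms(2,3) \<open>\<not> k \<ge> l\<close> by (auto simp: cyclic_walks_def nth_eq_iff_index_eq)
  qed
  assume "k = l"
  then have "xs ! i = ys ! i" if "i < k" for i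
    using cyclic_walk_nth[OF assms(1), of i] cyclic_walk_nth[OF assms(2), of i] assms that by simp
  with \<open>k = l\<close> show "xs = ys"
    using assms(1,2) by (auto simp: cyclic_walks_def intro: nth_equalityI)
qed

text \<open>Sending a walk to its head is injective, even across different lengths.\<close>

lemma sum_card_cyclic_walks_le:
  fixes f :: "'v::finite \<Rightarrow> 'v"
  shows "(\<Sum>k=1..n. card (cyclic_walks (functional_graph f) k)) \<le> CARD('v)"
proof -
  have "(\<Sum>k=1..n. card (cyclic_walks (functional_graph f) k)) = card (\<Union>k\<in>{1..n}. cyclic_walks (functional_graph f) k)"
    by (rule card_UN_disjoint[symmetric]) (auto simp: finite_cyclic_walks, auto simp: cyclic_walks_def)
  also have "\<dots> \<le> CARD('v)"
  proof (rule card_inj_on_le[of hd])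
    show "inj_on hd (\<Union>k\<in>{1..n}. cyclic_walks (functional_graph f) k)"
    proof (rule inj_onI)
      fix xs ys
      assume "xs \<in> (\<Union>k\<in>{1..n}. cyclic_walks (functional_graph f) k)"
        "ys \<in> (\<Union>k\<in>{1..n}. cyclic_walks (functional_graph f) k)" and hd: "hd xs = hd ys"
      then obtain k l where kl: "xs \<in> cyclic_walks (functional_graph f) k" "k > 0"
        "ys \<in> cyclic_walks (functional_graph f) l" "l > 0"
        by auto
      show "xs = ys"
        using cyclic_walk_eq[OF kl(1,3,2,4) hd] cyclic_walk_eq[OF kl(3,1,4,2) hd[symmetric]] by simp
    qed
  qed auto
  finally show ?thesis .
qed

lemma card_cycles_le:
  fixes f :: "'v::finite \<Rightarrow> 'v"
  shows "real (card (cycles (functional_graph f)))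
      \<le> (\<Sum>k=1..CARD('v). real (card (cyclic_walks (functional_graph f) k)) / real k)"
proof -
  let ?E = "functional_graph f"
  have "k_cycles ?E k = {}" if "k > CARD('v)" for k
  proof -
    have "cyclic_walks ?E k = {}"
      using that length_le_CARD[where ?'a = 'v] by (fastforce simp: cyclic_walks_def)
    then show ?thesis
      by (simp add: k_cycles_def quotient_def)
  qed
  then have "cycles ?E = (\<Union>k\<in>{1..CARD('v)}. k_cycles ?E k)"
    unfolding cycles_def by (force simp: not_less)
  then have "card (cycles ?E) \<le> (\<Sum>k=1..CARD('v). card (k_cycles ?E k))"
    by (simp add: card_UN_le)
  then have "real (card (cycles ?E)) \<le> (\<Sum>k=1..CARD('v). real (card (k_cycles ?E k)))"
    by (metis of_nat_le_iff of_nat_sum)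
  also have "\<dots> = (\<Sum>k=1..CARD('v). real (card (cyclic_walks ?E k)) / real k)"
    by (intro sum.cong refl) (simp add: card_k_cycles[symmetric])
  finally show ?thesis .
qed

text \<open>The cutoff \<open>m\<close> separates the lengths controlled on average from the long
  ones, where each walk weighs at most \<open>1 / (m + 1)\<close> and a single function has at most
  \<open>q + 1\<close> walks in all. For \<open>m = q + 1\<close> no long length remains.\<close>

lemma avg_cycles_le:
  assumes "m \<le> d + 2" "m \<le> CARD('a::finite_field) + 1"
  shows "avg_cycles TYPE('a) d \<le> (\<Sum>k=1..m. 1 / real k)
     + (if m = CARD('a) + 1 then 0 else (real (CARD('a)) + 1) / (real m + 1))"
proof -
  let ?R = "rf_of_degree d :: 'a ratfun set"
  let ?n = "CARD('a) + 1"
  define r where "r = (if m = ?n then 0 else (real (CARD('a)) + 1) / (real m + 1))"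
  define w where "w f k = real (card (cyclic_walks (functional_graph (rf_eval f)) k))" for f :: "'a ratfun" and k
  have n: "CARD('a proj_line) = ?n"
    by simp
  have long: "(\<Sum>k=Suc m..?n. w f k / real k) \<le> r" for f :: "'a ratfun"
  proof (cases "m = ?n")
    case False
    have "(\<Sum>k=Suc m..?n. w f k / real k) \<le> (\<Sum>k=Suc m..?n. w f k / real (Suc m))"
      by (intro sum_mono divide_left_mono) (auto simp: w_def)
    also have "\<dots> = (\<Sum>k=Suc m..?n. w f k) / real (Suc m)"
      by (rule sum_divide_distrib[symmetric])
    also have "(\<Sum>k=Suc m..?n. w f k) \<le> (\<Sum>k=1..?n. w f k)"
      by (intro sum_mono2) (auto simp: w_def)
    also have "\<dots> \<le> real ?n"
      using sum_card_cyclic_walks_le[of "rf_eval f" ?n] unfolding w_def n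
      by (metis of_nat_le_iff of_nat_sum)
    finally show ?thesis
      using False by (simp add: r_def add.commute divide_right_mono)
  qed (simp add: r_def)
  have cyc: "real (card (cycles (functional_graph (rf_eval f)))) \<le> (\<Sum>k=1..m. w f k / real k) + r" for f :: "'a ratfun"
  proof -
    have "real (card (cycles (functional_graph (rf_eval f)))) \<le> (\<Sum>k=1..?n. w f k / real k)"
      using card_cycles_le[of "rf_eval f"] unfolding w_def n .
    also have "{1..?n} = {1..m} \<union> {Suc m..?n}"
      using assms(2) by auto
    also have "(\<Sum>k\<in>{1..m} \<union> {Suc m..?n}. w f k / real k) = (\<Sum>k=1..m. w f k / real k) + (\<Sum>k=Suc m..?n. w f k / real k)"
      by (rule sum.union_disjoint) auto
    finally show ?thesis
      using long[of f] by linarith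
  qed
  have "(\<Sum>f\<in>?R. real (card (cycles (functional_graph (rf_eval f))))) \<le> (\<Sum>f\<in>?R. (\<Sum>k=1..m. w f k / real k) + r)"
    by (intro sum_mono cyc)
  also have "\<dots> = (\<Sum>k=1..m. (\<Sum>f\<in>?R. w f k) / real k) + real (card ?R) * r"
    by (simp add: sum.distrib sum.swap[of _ ?R] sum_divide_distrib)
  also have "\<dots> \<le> (\<Sum>k=1..m. real (card ?R) / real k) + real (card ?R) * r"
  proof (intro add_right_mono sum_mono divide_right_mono)
    fix k assume "k \<in> {1..m}"
    then have "k \<le> d + 2"
      using assms(1) by simp
    then show "(\<Sum>f\<in>?R. w f k) \<le> real (card ?R)"
      unfolding w_def of_nat_sum[symmetric] of_nat_le_iff by (rule sum_cyclic_walks_rf)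
  qed auto
  also have "\<dots> = real (card ?R) * ((\<Sum>k=1..m. 1 / real k) + r)"
    by (simp add: sum_distrib_left distrib_left)
  finally have "(\<Sum>f\<in>?R. real (card (cycles (functional_graph (rf_eval f)))))
      \<le> real (card ?R) * ((\<Sum>k=1..m. 1 / real k) + r)" .
  \<comment> \<open>Over an empty set of functions the average is a division by zero with value 0,
    so that case is settled by nonnegativity of the bound.\<close>
  moreover have "0 \<le> (\<Sum>k=1..m. 1 / real k) + r"
    by (auto simp: r_def intro!: add_nonneg_nonneg sum_nonneg)
  ultimately have "avg_cycles TYPE('a) d \<le> (\<Sum>k=1..m. 1 / real k) + r"
    by (cases "card ?R = 0") (simp_all add: avg_cycles_def pos_divide_le_eq mult.commute)
  then show ?thesis
    by (simp only: r_def)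
qed

theorem corollary3p7:
  fixes q d :: nat
  assumes "q = CARD('a::finite_field)"
  shows "(d < q - 1 \<longrightarrow>
            avg_cycles TYPE('a) d
              \<le> (real q + 1) / (real d + 2) + (1 + 2 / (real q)\<^sup>2) * (\<Sum>k=1..d+1. 1 / real k)) \<and>
         (d \<ge> q - 1 \<longrightarrow>
            avg_cycles TYPE('a) d \<le> (1 + 2 / (real q)\<^sup>2) * (\<Sum>k=1..q+1. 1 / real k))"
proof -
  \<comment> \<open>The factor \<open>1 + 2 / q^2\<close> is at least 1, so bounds by plain harmonic
    sums suffice.\<close>
  have H: "(\<Sum>k=1..m. 1 / real k) \<le> (1 + 2 / (real q)\<^sup>2) * (\<Sum>k=1..m. 1 / real k)" for m
    using mult_right_mono[of 1 "1 + 2 / (real q)\<^sup>2" "\<Sum>k=1..m. 1 / real k"]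
    by (simp add: sum_nonneg)
  \<comment> \<open>The cutoff \<open>m = d + 1\<close> gives the tail denominator
    \<open>m + 1 = d + 2\<close>, and \<open>d < q - 1\<close> keeps \<open>m\<close> below
    \<open>q + 1\<close>.\<close>
  have "avg_cycles TYPE('a) d \<le> (\<Sum>k=1..d+1. 1 / real k) + (real q + 1) / (real d + 2)" if "d < q - 1"
  proof -
    have "d \<noteq> CARD('a)" "d \<le> CARD('a)"
      using that assms by auto
    then show ?thesis
      using avg_cycles_le[of "d + 1" d, where ?'a = 'a] assms by (simp add: add_ac)
  qed
  \<comment> \<open>Here \<open>q + 1 \<le> d + 2\<close>, so the cutoff can be the number of all
    points and no tail is left.\<close>
  moreover have "avg_cycles TYPE('a) d \<le> (\<Sum>k=1..q+1. 1 / real k)" if "d \<ge> q - 1"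
    using avg_cycles_le[of "q + 1" d, where ?'a = 'a] that assms by simp
  ultimately show ?thesis
    using H[of "d + 1"] H[of "q + 1"] by force
qed

end
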